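(* Let $\alpha\in(0,2]$ and let $(\gamma,\delta)$ be admissible for $\alpha$. The discrete stable distribution $\mathcal{DS}(\alpha,\gamma,\delta)$ is discretely self-decomposable if and only if \[ \delta\ge\begin{cases}\alpha^2\gamma & \text{if }\alpha\neq1,\\ 2\gamma & \text{if }\alpha=1.\end{cases} \]
   Context: A count variable is a random variable taking values in $\mathbb{N}_0=\{0,1,2,\ldots\}$; its probability generating function (PGF) is $G(z;X)=\mathbb{E}[z^X]$. Convention: $0\log0=0$. $\mathcal{DS}(\alpha,\gamma,\delta)$, for $\alpha\in(0,2]$, is the distribution on $\mathbb{N}_0$ with PGF \[ G(z)=\begin{cases}\exp\left((z-1)\delta+\gamma(1-z)^\alpha\right) & \alpha\neq 1,\\ \exp\left((z-1)\delta+\gamma(1-z)\log(1-z)\right) & \alpha=1,\end{cases} \] where $(\gamma,\delta)\in\mathbb{R}^2$ is admissible for $\alpha$, meaning: $\gamma<0$ if $\alpha\in(0,1)$, $\gamma\ge0$ if $\alpha=1$, $\gamma>0$ if $\alpha\in(1,2]$, and $\delta\ge\alpha\gamma$. These are the paper's (broadly) discrete stable distributions. A count variable $X$ (or its distribution) is discretely self-decomposable if for all $\rho\in[0,1]$ its PGF satisfies \[G(z;X)=G(1+\rho(z-1);X)\,G_\rho(z)\] where $G_\rho(z)$ is a valid PGF of a count variable. *)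

theory Defs
  imports "HOL-Probability.Probability"
begin

text \<open>Distributions of count variables are represented as \<^typ>\<open>nat pmf\<close>.  Generating functions
  are real functions, compared on \<^term>\<open>{-1..1::real}\<close>, where the expectation converges for
  every count variable; this interval is mapped into itself by
  \<^term>\<open>\<lambda>z::real. 1 + \<rho> * (z - 1)\<close> whenever \<^term>\<open>\<rho> \<in> {0..1::real}\<close>.\<close>

definition pgf :: "nat pmf \<Rightarrow> real \<Rightarrow> real" where
  "pgf p z = measure_pmf.expectation p (\<lambda>n. z ^ n)"

definition ds_admissible :: "real \<Rightarrow> real \<Rightarrow> real \<Rightarrow> bool" where
  "ds_admissible \<alpha> \<gamma> \<delta> \<longleftrightarrow>
     (\<alpha> \<in> {0<..<1} \<longrightarrow> \<gamma> < 0) \<and>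
     (\<alpha> = 1 \<longrightarrow> \<gamma> \<ge> 0) \<and>
     (\<alpha> \<in> {1<..2} \<longrightarrow> \<gamma> > 0) \<and>
     \<delta> \<ge> \<alpha> * \<gamma>"

text \<open>At \<open>z = 1\<close> both cases have the value 1: for \<open>\<alpha> > 0\<close> we have \<open>0 powr \<alpha> = 0\<close>, and
  \<open>0 * ln 0 = 0\<close>.\<close>

definition ds_pgf :: "real \<Rightarrow> real \<Rightarrow> real \<Rightarrow> real \<Rightarrow> real" where
  "ds_pgf \<alpha> \<gamma> \<delta> z =
     (if \<alpha> \<noteq> 1 then exp ((z - 1) * \<delta> + \<gamma> * (1 - z) powr \<alpha>)
      else exp ((z - 1) * \<delta> + \<gamma> * (1 - z) * ln (1 - z)))"

text \<open>A distribution on the natural numbers is determined by its generating function, so there is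
  at most one such distribution; for \<open>\<alpha> \<in> {0<..2}\<close> and admissible \<open>(\<gamma>, \<delta>)\<close> there is one,
  since the power series of the exponent then has nonnegative coefficients apart from the
  constant one, i.e. the distribution is compound Poisson.\<close>

definition discrete_stable :: "real \<Rightarrow> real \<Rightarrow> real \<Rightarrow> nat pmf" where
  "discrete_stable \<alpha> \<gamma> \<delta> = (THE p. \<forall>z\<in>{-1..1}. pgf p z = ds_pgf \<alpha> \<gamma> \<delta> z)"

definition discretely_self_decomposable :: "nat pmf \<Rightarrow> bool" where
  "discretely_self_decomposable p \<longleftrightarrow>
     (\<forall>\<rho>\<in>{0..1}. \<exists>q :: nat pmf. \<forall>z\<in>{-1..1}.
        pgf p z = pgf p (1 + \<rho> * (z - 1)) * pgf q z)"

end

theory Submission imports Defs "HOL-Real_Asymp.Real_Asymp" begin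

text \<open>
  Write \<open>k z\<close> for \<open>(1 - z) powr \<alpha>\<close>, or for \<open>(1 - z) * ln (1 - z)\<close> when \<open>\<alpha> = 1\<close>, so that the
  generating function under study is \<open>exp ((z - 1) * \<delta> + \<gamma> * k z)\<close>.  Thinning replaces \<open>1 - z\<close> by
  \<open>\<rho> * (1 - z)\<close>, and \<open>k\<close> is homogeneous in \<open>1 - z\<close>, up to a term \<open>\<rho> * ln \<rho> * (1 - z)\<close> when
  \<open>\<alpha> = 1\<close>.  The quotient \<open>G z / G (1 + \<rho> * (z - 1))\<close> is therefore again a function of the same
  family (\<open>ds_pgf_quotient\<close>), with \<open>\<gamma>\<close> replaced by \<open>\<gamma> * (1 - \<rho> powr \<alpha>)\<close> and \<open>\<delta>\<close> by
  \<open>\<delta> * (1 - \<rho>)\<close>, to which \<open>\<gamma> * \<rho> * ln \<rho>\<close> is added when \<open>\<alpha> = 1\<close>.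

  So everything reduces to deciding which members of the family are generating functions.  For
  \<open>\<gamma>\<close> of the correct sign the answer is \<open>\<alpha> * \<gamma> \<le> \<delta>\<close> (\<open>ds_pgf_is_pgf_iff\<close>).  The coefficient of \<open>z\<close>
  in the exponent is \<open>\<delta> - \<alpha> * \<gamma>\<close>, and all later ones are nonnegative because of the sign of \<open>\<gamma>\<close>
  and \<open>\<alpha> \<le> 2\<close>.  If the first one is nonnegative too, then the exponent is \<open>c * (H z - 1)\<close> with \<open>H\<close> a generating
  function, and a compound Poisson distribution does the job (\<open>exp_powser_is_pgf\<close>).  Conversely,
  a generating function is nondecreasing on \<open>[0, 1]\<close>, so its logarithm has nonnegative derivative at 0.

  What is left is calculus in \<open>\<rho>\<close> (\<open>thinned_parameters_admissible_iff\<close>).  The slack in the inequality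
  for the quotient is a function of \<open>\<rho>\<close> which vanishes at \<open>\<rho> = 1\<close>.  It can be nonnegative on
  \<open>[0, 1]\<close> only if its derivative at 1 is at most 0, which is the stated bound on \<open>\<delta>\<close>.  That bound
  suffices because \<open>\<gamma> * \<rho> powr \<alpha>\<close> and \<open>\<gamma> * \<rho> * ln \<rho>\<close>, as functions of \<open>\<rho>\<close>, lie above their
  tangents at 1.
\<close>

section \<open>Generating functions of count variables\<close>

lemma abs_power_le_1:
  fixes z :: real
  assumes "z \<in> {-1..1}"
  shows "\<bar>z ^ n\<bar> \<le> 1"
  using assms by (auto simp: power_abs intro!: power_le_one)

lemma integrable_power:
  fixes z :: real and p :: "nat pmf"
  assumes "z \<in> {-1..1}"
  shows "integrable p (\<lambda>n. z ^ n)"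
  by (rule measure_pmf.integrable_const_bound[where B = 1])
     (use abs_power_le_1[OF assms] in auto)

lemma pgf_sums:
  assumes "z \<in> {-1..1}"
  shows "(\<lambda>n. pmf p n * z ^ n) sums pgf p z"
proof -
  have "integrable (count_space UNIV) (\<lambda>n. pmf p n * z ^ n)"
    using integrable_power[OF assms, of p]
    by (simp add: measure_pmf_eq_density integrable_density)
  then have "(\<lambda>n. pmf p n * z ^ n) sums (\<integral>n. pmf p n * z ^ n \<partial>count_space UNIV)"
    by (rule sums_integral_count_space_nat)
  also have "(\<integral>n. pmf p n * z ^ n \<partial>count_space UNIV) = pgf p z"
    by (simp add: pgf_def measure_pmf_eq_density integral_density)
  finally show ?thesis .
qed

lemma pgf_1 [simp]: "pgf p 1 = 1"
  by (simp add: pgf_def)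

lemma abs_pgf_le_1:
  assumes "z \<in> {-1..1}"
  shows "\<bar>pgf p z\<bar> \<le> 1"
proof -
  have "\<bar>pgf p z\<bar> \<le> measure_pmf.expectation p (\<lambda>n. \<bar>z ^ n\<bar>)"
    unfolding pgf_def by (rule integral_abs_bound)
  also have "\<dots> \<le> measure_pmf.expectation p (\<lambda>n. 1)"
    by (intro integral_mono integrable_abs integrable_power[OF assms])
       (use abs_power_le_1[OF assms] in auto)
  finally show ?thesis by simp
qed

lemma pgf_mono:
  assumes "0 \<le> x" "x \<le> y" "y \<le> 1"
  shows "pgf p x \<le> pgf p y"
  by (rule sums_le[OF _ pgf_sums pgf_sums])
     (use assms in \<open>auto intro!: mult_left_mono power_mono\<close>)

lemma continuous_on_pgf: "continuous_on {-1..1} (pgf p)"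
  unfolding pgf_def
  by (rule continuous_on_LINT_pmf[where B = 1])
     (auto intro!: continuous_intros simp: abs_power_le_1)

text \<open>Successively comparing constant terms: once the coefficients below \<open>n\<close> agree, the difference of
  the two series can be divided by \<open>z ^ n\<close>, and letting \<open>z\<close> tend to 0 isolates the next one.\<close>
lemma pgf_inject:
  assumes eq: "\<And>z. z \<in> {-1..1} \<Longrightarrow> pgf p z = pgf q z"
  shows "p = q"
proof (rule pmf_eqI)
  fix n
  show "pmf p n = pmf q n"
  proof (induction n rule: less_induct)
    case (less n)
    have "(\<lambda>k. (pmf p (k + n) - pmf q (k + n)) * z ^ k) sums 0" if "z \<noteq> 0" "\<bar>z\<bar> < 1" for z :: real
    proof -
      have z: "z \<in> {-1..1}" using that by auto
      have "(\<lambda>k. (pmf p k - pmf q k) * z ^ k) sums 0"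
        using sums_diff[OF pgf_sums[OF z, of p] pgf_sums[OF z, of q]] eq[OF z]
        by (simp add: algebra_simps)
      then have "(\<lambda>k. (pmf p (k + n) - pmf q (k + n)) * z ^ (k + n)) sums 0"
        using less.IH by (subst sums_zero_iff_shift) auto
      then have "(\<lambda>k. (pmf p (k + n) - pmf q (k + n)) * z ^ (k + n) / z ^ n) sums (0 / z ^ n)"
        by (rule sums_divide)
      then show ?thesis using that by (simp add: power_add)
    qed
    then have "((\<lambda>z. 0) \<longlongrightarrow> pmf p (0 + n) - pmf q (0 + n)) (at (0::real))"
      by (intro powser_limit_0_strong[where s = 1]) auto
    then show ?case
      by (simp add: tendsto_const_iff)
  qed
qed

lemma pgf_bind:
  assumes "z \<in> {-1..1}"
  shows "pgf (bind_pmf p f) z = measure_pmf.expectation p (\<lambda>x. pgf (f x) z)"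
  unfolding pgf_def measure_pmf_bind
  by (rule integral_bind[where K = "count_space UNIV" and B = 1 and B' = 1])
     (use measurable_measure_pmf[of f] abs_power_le_1[OF assms]
      in \<open>auto intro: measure_pmf.finite_measure\<close>)

lemma pgf_convolution:
  assumes "z \<in> {-1..1}"
  shows "pgf (bind_pmf p (\<lambda>m. map_pmf (\<lambda>n. m + n) q)) z = pgf p z * pgf q z"
proof -
  have "pgf (map_pmf (\<lambda>n. m + n) q) z = z ^ m * pgf q z" for m
    by (simp add: pgf_def power_add)
  then show ?thesis
    by (simp add: pgf_bind[OF assms]) (simp add: pgf_def)
qed

section \<open>Compound Poisson distributions\<close>

primrec convolution_power :: "nat pmf \<Rightarrow> nat \<Rightarrow> nat pmf" where
  "convolution_power \<mu> 0 = return_pmf 0"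
| "convolution_power \<mu> (Suc k) = bind_pmf \<mu> (\<lambda>m. map_pmf (\<lambda>n. m + n) (convolution_power \<mu> k))"

lemma pgf_convolution_power:
  assumes "z \<in> {-1..1}"
  shows "pgf (convolution_power \<mu> k) z = pgf \<mu> z ^ k"
  by (induction k) (auto simp: pgf_convolution[OF assms], simp add: pgf_def)

lemma pgf_poisson:
  assumes "0 < c" "z \<in> {-1..1}"
  shows "pgf (poisson_pmf c) z = exp (c * (z - 1))"
proof -
  have "(\<lambda>n. exp (- c) * ((c * z) ^ n /\<^sub>R fact n)) sums (exp (- c) * exp (c * z))"
    by (intro sums_mult exp_converges)
  moreover have "pmf (poisson_pmf c) n * z ^ n = exp (- c) * ((c * z) ^ n /\<^sub>R fact n)" for n
    using assms by (simp add: power_mult_distrib field_simps)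
  ultimately have "(\<lambda>n. pmf (poisson_pmf c) n * z ^ n) sums (exp (- c) * exp (c * z))"
    by simp
  with pgf_sums[OF assms(2)] have "pgf (poisson_pmf c) z = exp (- c) * exp (c * z)"
    by (rule sums_unique2)
  then show ?thesis by (simp add: exp_add[symmetric] algebra_simps)
qed

text \<open>The distribution of the sum of a Poisson number, with mean \<open>c\<close>, of independent copies of \<open>\<mu>\<close>.\<close>
lemma compound_poisson:
  assumes "0 \<le> c"
  obtains p where "\<And>z. z \<in> {-1..1} \<Longrightarrow> pgf p z = exp (c * (pgf \<mu> z - 1))"
proof (cases "c = 0")
  case True
  then have "pgf (return_pmf 0) z = exp (c * (pgf \<mu> z - 1))" for z
    by (simp add: pgf_def)
  then show ?thesis using that by blast
next
  case False
  with assms have "0 < c" by simp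
  show ?thesis
  proof
    fix z :: real assume z: "z \<in> {-1..1}"
    have "pgf (bind_pmf (poisson_pmf c) (convolution_power \<mu>)) z = pgf (poisson_pmf c) (pgf \<mu> z)"
      by (simp add: pgf_bind[OF z] pgf_convolution_power[OF z]) (simp add: pgf_def)
    also have "\<dots> = exp (c * (pgf \<mu> z - 1))"
      using abs_pgf_le_1[OF z, of \<mu>] by (intro pgf_poisson \<open>0 < c\<close>) auto
    finally show "pgf (bind_pmf (poisson_pmf c) (convolution_power \<mu>)) z = \<dots>" .
  qed
qed

text \<open>Normalisation of weights, in a form that remains true when the total weight is 0.\<close>
lemma pmf_of_nonneg_weights:
  fixes a :: "nat \<Rightarrow> real"
  assumes nonneg: "\<And>n. 0 \<le> a n" and a: "a sums c"
  obtains \<mu> where "\<And>n. c * pmf \<mu> n = a n"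
proof (cases "c = 0")
  case True
  then have "a n = 0" for n
    using suminf_eq_zero_iff[OF sums_summable[OF a] nonneg] sums_unique[OF a] by simp
  with True that show ?thesis by simp
next
  case False
  have "0 \<le> c" by (rule sums_le[OF _ sums_zero a]) (rule nonneg)
  with False have c: "0 < c" by simp
  have "(\<Sum>n. ennreal (a n / c)) = ennreal (c / c)"
    using nonneg c by (intro suminf_ennreal_eq sums_divide a) auto
  then have "(\<integral>\<^sup>+n. ennreal (a n / c) \<partial>count_space UNIV) = 1"
    using c by (simp add: nn_integral_count_space_nat)
  then have "pmf (embed_pmf (\<lambda>n. a n / c)) n = a n / c" for n
    using nonneg c by (intro pmf_embed_pmf) auto
  then have "c * pmf (embed_pmf (\<lambda>n. a n / c)) n = a n" for n
    using c by simp
  then show ?thesis by (rule that)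
qed

text \<open>The exponent is \<open>c * (pgf \<mu> z - 1)\<close>, where \<open>\<mu>\<close> has the weights \<open>a n\<close> for \<open>n > 0\<close>, normalised by
  their sum \<open>c\<close>.  That these weights are summable has to be deduced from the behaviour of \<open>L\<close> at 1, as
  in Abel's theorem; the same continuity carries the identity from the open interval to its
  end points.\<close>
lemma exp_powser_is_pgf:
  fixes L :: "real \<Rightarrow> real" and a :: "nat \<Rightarrow> real"
  assumes cont: "continuous_on {-1..1} L" and L1: "L 1 = 0"
    and sums: "\<And>z. \<bar>z\<bar> < 1 \<Longrightarrow> (\<lambda>n. a n * z ^ n) sums L z"
    and nonneg: "\<And>n. 0 < n \<Longrightarrow> 0 \<le> a n"
  obtains p where "\<And>z. z \<in> {-1..1} \<Longrightarrow> pgf p z = exp (L z)"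
proof -
  define b where "b n = (if n = 0 then 0 else a n)" for n
  have b_nonneg: "0 \<le> b n" for n by (simp add: b_def nonneg)
  have b_sums: "(\<lambda>n. b n * z ^ n) sums (L z - a 0)" if "\<bar>z\<bar> < 1" for z
  proof -
    have "(\<lambda>n. a n * z ^ n - (if n = 0 then a 0 else 0)) sums (L z - a 0)"
      by (intro sums_diff sums that) (rule sums_single)
    also have "(\<lambda>n. a n * z ^ n - (if n = 0 then a 0 else 0)) = (\<lambda>n. b n * z ^ n)"
      by (auto simp: b_def)
    finally show ?thesis .
  qed
  (* For 0 < z < 1 nonnegativity bounds the partial sums by L z - a 0; then z tends to 1. *)
  have "(\<Sum>n<N. b n) \<le> - a 0" for N
  proof -
    have "((\<lambda>z. \<Sum>n<N. b n * z ^ n) \<longlongrightarrow> (\<Sum>n<N. b n * 1 ^ n)) (at_left 1)"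
      by (intro tendsto_intros)
    moreover have "((\<lambda>z. L z - a 0) \<longlongrightarrow> L 1 - a 0) (at_left 1)"
    proof (intro tendsto_intros)
      have "(L \<longlongrightarrow> L 1) (at 1 within {-1..1})"
        using cont by (simp add: continuous_on_def)
      then show "(L \<longlongrightarrow> L 1) (at_left 1)"
        by (simp add: at_within_Icc_at_left)
    qed
    moreover have "\<forall>\<^sub>F z in at_left 1. (\<Sum>n<N. b n * z ^ n) \<le> L z - a 0"
      using eventually_at_left_real[of 0 1]
    proof (rule eventually_mono)
      fix z :: real assume z: "z \<in> {0<..<1}"
      then have "(\<lambda>n. b n * z ^ n) sums (L z - a 0)" by (intro b_sums) auto
      then show "(\<Sum>n<N. b n * z ^ n) \<le> L z - a 0"
        using z b_nonneg sum_le_suminf[of "\<lambda>n. b n * z ^ n" "{..<N}"]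
        by (auto simp: sums_iff)
    qed simp
    ultimately have "(\<Sum>n<N. b n * 1 ^ n) \<le> L 1 - a 0"
      by (intro tendsto_le[where F = "at_left (1::real)"]) auto
    then show ?thesis by (simp add: L1)
  qed
  then have "summable b"
    by (intro summableI_nonneg_bounded b_nonneg)
  then obtain c where c: "b sums c" by blast
  have "0 \<le> c" by (rule sums_le[OF _ sums_zero c]) (rule b_nonneg)
  obtain \<mu> where \<mu>: "\<And>n. c * pmf \<mu> n = b n"
    using pmf_of_nonneg_weights[OF b_nonneg c] by blast
  have "c * pgf \<mu> z - L z = - a 0" if z: "z \<in> {-1..1}" for z
  proof (rule continuous_constant_on_closure[where f = "\<lambda>z. c * pgf \<mu> z - L z" and S = "{-1<..<1}"])
    show "continuous_on (closure {-1<..<1}) (\<lambda>z. c * pgf \<mu> z - L z)"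
      using cont continuous_on_pgf by (auto intro!: continuous_intros)
    show "z \<in> closure {-1<..<1}" using z by simp
    fix w :: real assume w: "w \<in> {-1<..<1}"
    have "(\<lambda>n. c * (pmf \<mu> n * w ^ n)) sums (c * pgf \<mu> w)"
      using w by (intro sums_mult pgf_sums) auto
    then have "(\<lambda>n. b n * w ^ n) sums (c * pgf \<mu> w)"
      by (simp add: mult.assoc[symmetric] \<mu>)
    with b_sums[of w] w have "c * pgf \<mu> w = L w - a 0"
      by (auto intro: sums_unique2)
    then show "c * pgf \<mu> w - L w = - a 0" by simp
  qed
  (* The value at 1 identifies the total weight: c = - a 0. *)
  from this[of 1] this have "L z = c * (pgf \<mu> z - 1)" if "z \<in> {-1..1}" for z
    using that by (auto simp: L1 algebra_simps)
  with compound_poisson[OF \<open>0 \<le> c\<close>, of \<mu>] show ?thesis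
    using that by metis
qed

section \<open>Validity of the discrete stable generating functions\<close>

definition stable_kernel :: "real \<Rightarrow> real \<Rightarrow> real" where
  "stable_kernel \<alpha> z = (if \<alpha> \<noteq> 1 then (1 - z) powr \<alpha> else (1 - z) * ln (1 - z))"

text \<open>For \<open>\<alpha> = 1\<close> these are \<open>-1\<close> at \<open>n = 1\<close>, by \<open>1 / 0 = 0\<close>, and \<open>1 / (n * (n - 1))\<close> for \<open>n \<ge> 2\<close>.\<close>
definition stable_kernel_coeff :: "real \<Rightarrow> nat \<Rightarrow> real" where
  "stable_kernel_coeff \<alpha> n =
     (if \<alpha> \<noteq> 1 then (-1) ^ n * (\<alpha> gchoose n)
      else (if n = 0 then 0 else 1 / (real n - 1) - 1 / real n))"

lemma ds_pgf_eq: "ds_pgf \<alpha> \<gamma> \<delta> z = exp ((z - 1) * \<delta> + \<gamma> * stable_kernel \<alpha> z)"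
  by (simp add: ds_pgf_def stable_kernel_def)

lemma stable_kernel_1 [simp]: "stable_kernel \<alpha> 1 = 0"
  by (simp add: stable_kernel_def)

lemma stable_kernel_sums:
  assumes z: "\<bar>z\<bar> < 1"
  shows "(\<lambda>n. stable_kernel_coeff \<alpha> n * z ^ n) sums stable_kernel \<alpha> z"
proof (cases "\<alpha> = 1")
  case False
  have "(\<lambda>n. (\<alpha> gchoose n) * (- z) ^ n) sums (1 + - z) powr \<alpha>"
    using z by (intro gen_binomial_real) auto
  with False show ?thesis
    by (simp add: stable_kernel_def stable_kernel_coeff_def power_minus[of z] mult_ac)
next
  case True
  have ln: "(\<lambda>n. - (z ^ n / real n)) sums ln (1 - z)"
    using ln_series'[of "- z"] z by simp
  then have "(\<lambda>n. z * (- (z ^ n / real n))) sums (z * ln (1 - z))"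
    by (rule sums_mult)
  then have "(\<lambda>n. if n = 0 then 0 else - (z ^ n / (real n - 1))) sums (z * ln (1 - z))"
    using sums_Suc_iff[of "\<lambda>n. if n = 0 then 0 else - (z ^ n / (real n - 1))" "z * ln (1 - z)"]
    by simp
  from sums_diff[OF ln this]
  have "(\<lambda>n. - (z ^ n / real n) - (if n = 0 then 0 else - (z ^ n / (real n - 1)))) sums
          stable_kernel \<alpha> z"
    using True by (simp add: stable_kernel_def algebra_simps)
  also have "(\<lambda>n. - (z ^ n / real n) - (if n = 0 then 0 else - (z ^ n / (real n - 1)))) =
      (\<lambda>n. stable_kernel_coeff \<alpha> n * z ^ n)"
    using True by (auto simp: stable_kernel_coeff_def algebra_simps)
  finally show ?thesis .
qed

lemma stable_kernel_coeff_1: "stable_kernel_coeff \<alpha> (Suc 0) = - \<alpha>"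
  by (simp add: stable_kernel_coeff_def)

text \<open>The sign condition on \<open>\<gamma>\<close> in the definition of admissibility, except that \<open>\<gamma> = 0\<close> is included
  for every \<open>\<alpha>\<close>: thinning with \<open>\<rho> = 1\<close> leads to that degenerate case.\<close>
definition ds_sign :: "real \<Rightarrow> real \<Rightarrow> bool" where
  "ds_sign \<alpha> \<gamma> \<longleftrightarrow> 0 \<le> \<gamma> * (\<alpha> - 1) \<and> (\<alpha> = 1 \<longrightarrow> 0 \<le> \<gamma>)"

text \<open>Successive coefficients of \<open>(1 - z) powr \<alpha>\<close> have ratio \<open>(n - \<alpha>) / (n + 1)\<close>, which is nonnegative
  from \<open>n = 2\<close> on because \<open>\<alpha> \<le> 2\<close>; so they are nonnegative multiples of the one at \<open>n = 2\<close>,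
  which is \<open>\<alpha> * (\<alpha> - 1) / 2\<close>.\<close>
lemma stable_kernel_coeff_sign:
  assumes \<alpha>: "\<alpha> \<in> {0<..2}" and sign: "ds_sign \<alpha> \<gamma>" and "2 \<le> n"
  shows "0 \<le> \<gamma> * stable_kernel_coeff \<alpha> n"
proof (cases "\<alpha> = 1")
  case True
  with \<open>2 \<le> n\<close> sign show ?thesis
    by (auto simp: stable_kernel_coeff_def ds_sign_def field_simps)
next
  case False
  have rec: "stable_kernel_coeff \<alpha> (Suc n) = stable_kernel_coeff \<alpha> n * ((real n - \<alpha>) / real (Suc n))"
    for n
  proof -
    have "(\<alpha> gchoose Suc n) = (\<alpha> - real n) * (\<alpha> gchoose n) / real (Suc n)"
      using gbinomial_mult_1[of \<alpha> n] by (simp add: field_simps)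
    then have "(-1) ^ Suc n * (\<alpha> gchoose Suc n) =
        (-1) ^ n * (\<alpha> gchoose n) * ((real n - \<alpha>) / real (Suc n))"
      by (simp only:) (simp add: field_simps)
    then show ?thesis using False by (simp add: stable_kernel_coeff_def)
  qed
  from \<open>2 \<le> n\<close> show ?thesis
  proof (induction n rule: dec_induct)
    case base
    have "stable_kernel_coeff \<alpha> 2 = (\<alpha> - 1) * \<alpha> / 2"
      using rec[of 1] by (simp add: stable_kernel_coeff_1 numeral_2_eq_2[symmetric] field_simps)
    then have "\<gamma> * stable_kernel_coeff \<alpha> 2 = \<gamma> * (\<alpha> - 1) * \<alpha> / 2"
      by simp
    also have "0 \<le> \<dots>"
      using \<alpha> sign by (simp add: ds_sign_def)
    finally show ?case .
  next
    case (step n)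
    have "0 \<le> (real n - \<alpha>) / real (Suc n)"
      using \<alpha> step.hyps by auto
    then show ?case
      using step.IH by (metis rec mult.assoc mult_nonneg_nonneg)
  qed
qed

lemma continuous_on_stable_kernel:
  assumes "0 < \<alpha>"
  shows "continuous_on {-1..1} (stable_kernel \<alpha>)"
proof (cases "\<alpha> = 1")
  case False
  then show ?thesis unfolding stable_kernel_def
    using assms by (auto intro!: continuous_intros continuous_on_powr')
next
  case True
  have "continuous (at x within {0..}) (\<lambda>x. x * ln x)" if "0 \<le> x" for x :: real
  proof (cases "x = 0")
    case True
    have "((\<lambda>x::real. x * ln x) \<longlongrightarrow> 0) (at_right 0)" by real_asymp
    then show ?thesis using True by (simp add: continuous_within at_within_Ici_at_right)
  next
    case False
    with that show ?thesis by (auto intro!: continuous_intros)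
  qed
  then have "continuous_on {0..} (\<lambda>x::real. x * ln x)"
    by (auto simp: continuous_on_eq_continuous_within)
  then have "continuous_on {-1..1} (\<lambda>z::real. (1 - z) * ln (1 - z))"
    by (rule continuous_on_compose2) (auto intro!: continuous_intros)
  with True show ?thesis by (simp add: stable_kernel_def[abs_def])
qed

lemma stable_kernel_deriv_0: "(stable_kernel \<alpha> has_real_derivative - \<alpha>) (at 0)"
proof (cases "\<alpha> = 1")
  case False
  then show ?thesis unfolding stable_kernel_def[abs_def]
    by (auto intro!: derivative_eq_intros)
next
  case True
  then show ?thesis unfolding stable_kernel_def[abs_def]
    by (auto intro!: derivative_eq_intros)
qed

text \<open>The number \<open>\<delta> - \<alpha> * \<gamma>\<close> plays two roles: it is the derivative at 0 of the exponent, hence nonnegative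
  when the exponential is nondecreasing on \<open>[0, 1]\<close>, and it is the only coefficient of positive order
  in the exponent whose sign is not determined by that of \<open>\<gamma>\<close>.\<close>
lemma ds_pgf_is_pgf_iff:
  assumes \<alpha>: "\<alpha> \<in> {0<..2}" and sign: "ds_sign \<alpha> \<gamma>"
  shows "(\<exists>p. \<forall>z\<in>{-1..1}. pgf p z = ds_pgf \<alpha> \<gamma> \<delta> z) \<longleftrightarrow> \<alpha> * \<gamma> \<le> \<delta>"
proof
  let ?L = "\<lambda>z. (z - 1) * \<delta> + \<gamma> * stable_kernel \<alpha> z"
  assume "\<exists>p. \<forall>z\<in>{-1..1}. pgf p z = ds_pgf \<alpha> \<gamma> \<delta> z"
  then obtain p where p: "\<forall>z\<in>{-1..1}. pgf p z = exp (?L z)"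
    unfolding ds_pgf_eq by blast
  have mono: "?L 0 \<le> ?L h" if "0 \<le> h" "h \<le> 1" for h
    using pgf_mono[of 0 h p] that by (simp add: p)
  have deriv: "(?L has_real_derivative \<delta> - \<alpha> * \<gamma>) (at 0)"
    by (auto intro!: derivative_eq_intros stable_kernel_deriv_0)
  show "\<alpha> * \<gamma> \<le> \<delta>"
  proof (rule ccontr)
    assume "\<not> \<alpha> * \<gamma> \<le> \<delta>"
    then obtain d where "0 < d" and d: "\<And>h. 0 < h \<Longrightarrow> h < d \<Longrightarrow> ?L 0 > ?L (0 + h)"
      using DERIV_neg_dec_right[OF deriv] by auto
    have "?L (0 + min (d / 2) 1) < ?L 0"
      by (rule d) (use \<open>0 < d\<close> in auto)
    moreover have "?L 0 \<le> ?L (min (d / 2) 1)"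
      by (rule mono) (use \<open>0 < d\<close> in auto)
    ultimately show False by simp
  qed
next
  assume \<delta>: "\<alpha> * \<gamma> \<le> \<delta>"
  let ?L = "\<lambda>z. (z - 1) * \<delta> + \<gamma> * stable_kernel \<alpha> z"
  define l where "l n = (if n = 0 then - \<delta> else if n = Suc 0 then \<delta> else 0)" for n
  define a where "a n = l n + \<gamma> * stable_kernel_coeff \<alpha> n" for n
  have "(\<lambda>n. a n * z ^ n) sums ?L z" if "\<bar>z\<bar> < 1" for z
  proof -
    have "(\<lambda>n. l n * z ^ n) sums (\<Sum>n\<in>{0, Suc 0}. l n * z ^ n)"
      by (rule sums_finite) (auto simp: l_def)
    then have "(\<lambda>n. l n * z ^ n) sums ((z - 1) * \<delta>)"
      by (simp add: l_def algebra_simps)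
    from sums_add[OF this sums_mult[OF stable_kernel_sums[OF that], of \<gamma>]]
    show ?thesis by (simp add: a_def algebra_simps)
  qed
  moreover have "0 \<le> a n" if "0 < n" for n
  proof (cases "n = 1")
    case True
    then show ?thesis using \<delta> by (simp add: a_def l_def stable_kernel_coeff_1 mult.commute)
  next
    case False
    with that have "2 \<le> n" by simp
    then show ?thesis
      using stable_kernel_coeff_sign[OF \<alpha> sign] False by (simp add: a_def l_def)
  qed
  moreover have "continuous_on {-1..1} ?L"
    using \<alpha> by (intro continuous_intros continuous_on_stable_kernel) auto
  ultimately obtain p where "\<And>z. z \<in> {-1..1} \<Longrightarrow> pgf p z = exp (?L z)"
    using exp_powser_is_pgf[of ?L a] by auto
  then show "\<exists>p. \<forall>z\<in>{-1..1}. pgf p z = ds_pgf \<alpha> \<gamma> \<delta> z"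
    unfolding ds_pgf_eq by blast
qed

lemma pgf_discrete_stable:
  assumes "\<alpha> \<in> {0<..2}" "ds_sign \<alpha> \<gamma>" "\<alpha> * \<gamma> \<le> \<delta>" "z \<in> {-1..1}"
  shows "pgf (discrete_stable \<alpha> \<gamma> \<delta>) z = ds_pgf \<alpha> \<gamma> \<delta> z"
proof -
  obtain p where p: "\<forall>z\<in>{-1..1}. pgf p z = ds_pgf \<alpha> \<gamma> \<delta> z"
    using ds_pgf_is_pgf_iff assms by blast
  have "\<forall>z\<in>{-1..1}. pgf (discrete_stable \<alpha> \<gamma> \<delta>) z = ds_pgf \<alpha> \<gamma> \<delta> z"
    unfolding discrete_stable_def
    by (rule theI[where P = "\<lambda>p. \<forall>z\<in>{-1..1}. pgf p z = ds_pgf \<alpha> \<gamma> \<delta> z", OF p])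
       (use p in \<open>auto intro: pgf_inject\<close>)
  with assms show ?thesis by blast
qed

section \<open>Thinning\<close>

text \<open>The defect in the homogeneity of the kernel.\<close>
definition log_drift :: "real \<Rightarrow> real \<Rightarrow> real" where
  "log_drift \<alpha> \<rho> = (if \<alpha> = 1 then \<rho> * ln \<rho> else 0)"

lemma stable_kernel_thin:
  assumes "0 \<le> \<rho>" "z \<le> 1"
  shows "stable_kernel \<alpha> (1 + \<rho> * (z - 1)) =
    \<rho> powr \<alpha> * stable_kernel \<alpha> z + log_drift \<alpha> \<rho> * (1 - z)"
proof -
  have "1 - (1 + \<rho> * (z - 1)) = \<rho> * (1 - z)" by (simp add: algebra_simps)
  then have *: "stable_kernel \<alpha> (1 + \<rho> * (z - 1)) =
      (if \<alpha> \<noteq> 1 then (\<rho> * (1 - z)) powr \<alpha> else \<rho> * (1 - z) * ln (\<rho> * (1 - z)))"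
    by (simp only: stable_kernel_def)
  show ?thesis
  proof (cases "\<rho> = 0 \<or> z = 1")
    case True
    then show ?thesis unfolding * by (auto simp: log_drift_def)
  next
    case False
    with assms have "0 < \<rho>" "0 < 1 - z" by auto
    then have "(\<rho> * (1 - z)) powr \<alpha> = \<rho> powr \<alpha> * (1 - z) powr \<alpha>"
      and "ln (\<rho> * (1 - z)) = ln \<rho> + ln (1 - z)"
      by (simp_all add: powr_mult ln_mult del: right_diff_distrib)
    then show ?thesis
      unfolding * using \<open>0 < \<rho>\<close> by (simp add: stable_kernel_def log_drift_def) (simp add: algebra_simps)
  qed
qed

lemma ds_pgf_quotient:
  assumes "0 \<le> \<rho>" "z \<le> 1"
  shows "ds_pgf \<alpha> \<gamma> \<delta> z / ds_pgf \<alpha> \<gamma> \<delta> (1 + \<rho> * (z - 1)) =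
    ds_pgf \<alpha> (\<gamma> * (1 - \<rho> powr \<alpha>)) (\<delta> * (1 - \<rho>) + \<gamma> * log_drift \<alpha> \<rho>) z"
  unfolding ds_pgf_eq stable_kernel_thin[OF assms] exp_diff[symmetric]
  by (simp add: algebra_simps)

text \<open>As \<open>\<gamma> * (\<alpha> - 1)\<close> is nonnegative, \<open>\<gamma> * x powr \<alpha>\<close> is convex in \<open>x\<close> and so lies above its tangent
  at 1.\<close>
lemma powr_tangent_bound:
  assumes "ds_sign \<alpha> \<gamma>" "0 < \<alpha>" "\<rho> \<in> {0..1}"
  shows "\<gamma> * (1 - \<rho> powr \<alpha>) \<le> \<gamma> * (\<alpha> * (1 - \<rho>))"
proof (cases "\<rho> = 0")
  case True
  with assms show ?thesis by (simp add: ds_sign_def algebra_simps)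
next
  case False
  (* h is, up to a constant, the excess over the tangent at 1; it decreases towards x = 1. *)
  define h where "h x = \<gamma> * (x powr \<alpha> - \<alpha> * x)" for x
  have "h 1 \<le> h \<rho>"
  proof (rule DERIV_nonpos_imp_nonincreasing[where f = h])
    show "\<rho> \<le> 1" using assms by simp
    fix x assume x: "\<rho> \<le> x" "x \<le> 1"
    with False assms have "0 < x" by auto
    have "(h has_real_derivative \<gamma> * (\<alpha> * x powr (\<alpha> - 1) - \<alpha>)) (at x)"
      unfolding h_def[abs_def] using \<open>0 < x\<close> by (auto intro!: derivative_eq_intros)
    moreover have "\<gamma> * (\<alpha> * x powr (\<alpha> - 1) - \<alpha>) \<le> 0"
    proof (cases "1 \<le> \<alpha>")
      case True
      then have "0 \<le> \<gamma>" using assms by (auto simp: ds_sign_def zero_le_mult_iff)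
      moreover have "x powr (\<alpha> - 1) \<le> 1"
        using True x \<open>0 < x\<close> by (intro powr_le1) auto
      ultimately show ?thesis
        using assms by (auto simp: mult_le_0_iff)
    next
      case False
      then have "\<gamma> \<le> 0" using assms by (auto simp: ds_sign_def zero_le_mult_iff)
      moreover have "1 \<le> x powr (\<alpha> - 1)"
        using False x \<open>0 < x\<close> powr_mono2'[of "\<alpha> - 1" x 1] by simp
      ultimately show ?thesis
        using assms by (auto simp: mult_le_0_iff)
    qed
    ultimately show "\<exists>y. (h has_real_derivative y) (at x) \<and> y \<le> 0" by blast
  qed
  then show ?thesis by (simp add: h_def algebra_simps)
qed

text \<open>The left-hand side says that the parameters of the quotient satisfy the criterion
  \<open>ds_pgf_is_pgf_iff\<close> for every \<open>\<rho>\<close>.  Both sides of the inequality vanish at \<open>\<rho> = 1\<close>, and the bound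
  on \<open>\<delta>\<close> compares their derivatives there.\<close>
lemma thinned_parameters_admissible_iff:
  assumes \<alpha>: "0 < \<alpha>" and sign: "ds_sign \<alpha> \<gamma>"
  shows "(\<forall>\<rho>\<in>{0..1}. \<alpha> * (\<gamma> * (1 - \<rho> powr \<alpha>)) \<le> \<delta> * (1 - \<rho>) + \<gamma> * log_drift \<alpha> \<rho>) \<longleftrightarrow>
    (if \<alpha> \<noteq> 1 then \<alpha>^2 * \<gamma> else 2 * \<gamma>) \<le> \<delta>"
    (is "?lhs \<longleftrightarrow> ?c \<le> \<delta>")
proof
  assume ?lhs
  define f where
    "f \<rho> = \<delta> * (1 - \<rho>) + \<gamma> * log_drift \<alpha> \<rho> - \<alpha> * (\<gamma> * (1 - \<rho> powr \<alpha>))" for \<rho>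
  have nonneg: "0 \<le> f \<rho>" if "0 \<le> \<rho>" "\<rho> \<le> 1" for \<rho>
    using \<open>?lhs\<close> that by (simp add: f_def)
  have [simp]: "f 1 = 0" by (simp add: f_def log_drift_def)
  have "((\<lambda>x::real. x * ln x) has_real_derivative 1) (at 1)"
    by (rule DERIV_cong[OF DERIV_mult[OF DERIV_ident DERIV_ln_divide]]) auto
  then have log_drift_deriv: "(log_drift \<alpha> has_real_derivative of_bool (\<alpha> = 1)) (at 1)"
    by (simp add: log_drift_def[abs_def])
  have powr_deriv: "((\<lambda>x::real. x powr \<alpha>) has_real_derivative \<alpha>) (at 1)"
    by (auto intro!: derivative_eq_intros)
  have deriv: "(f has_real_derivative ?c - \<delta>) (at 1)"
    unfolding f_def[abs_def]
    by (rule derivative_eq_intros log_drift_deriv powr_deriv refl)+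
       (auto simp: power2_eq_square algebra_simps)
  show "?c \<le> \<delta>"
  proof (rule ccontr)
    assume "\<not> ?c \<le> \<delta>"
    then obtain d where "0 < d" and d: "\<And>h. 0 < h \<Longrightarrow> h < d \<Longrightarrow> f (1 - h) < f 1"
      using DERIV_pos_inc_left[OF deriv] by auto
    have "f (1 - min (d / 2) 1) < f 1"
      by (rule d) (use \<open>0 < d\<close> in auto)
    moreover have "0 \<le> f (1 - min (d / 2) 1)"
      by (rule nonneg) (use \<open>0 < d\<close> in auto)
    ultimately show False by simp
  qed
next
  assume c: "?c \<le> \<delta>"
  show ?lhs
  proof
    fix \<rho> :: real assume \<rho>: "\<rho> \<in> {0..1}"
    show "\<alpha> * (\<gamma> * (1 - \<rho> powr \<alpha>)) \<le> \<delta> * (1 - \<rho>) + \<gamma> * log_drift \<alpha> \<rho>"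
    proof (cases "\<alpha> = 1")
      case False
      have "\<alpha> * (\<gamma> * (1 - \<rho> powr \<alpha>)) \<le> \<alpha> * (\<gamma> * (\<alpha> * (1 - \<rho>)))"
        by (rule mult_left_mono[OF powr_tangent_bound[OF sign \<alpha> \<rho>]]) (use \<alpha> in simp)
      also have "\<dots> = ?c * (1 - \<rho>)" using False by (simp add: power2_eq_square)
      also have "\<dots> \<le> \<delta> * (1 - \<rho>)" using c \<rho> by (intro mult_right_mono) auto
      finally show ?thesis using False by (simp add: log_drift_def)
    next
      case True
      have "\<rho> - 1 \<le> \<rho> * ln \<rho>"
      proof (cases "\<rho> = 0")
        case False
        with \<rho> have "- ln \<rho> \<le> 1 / \<rho> - 1"
          using ln_le_minus_one[of "1 / \<rho>"] by (simp add: ln_div)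
        with \<rho> False show ?thesis by (simp add: field_simps)
      qed simp
      then have "\<gamma> * (\<rho> - 1) \<le> \<gamma> * (\<rho> * ln \<rho>)"
        using sign True by (intro mult_left_mono) (auto simp: ds_sign_def)
      moreover have "2 * \<gamma> * (1 - \<rho>) \<le> \<delta> * (1 - \<rho>)"
        using c \<rho> True by (intro mult_right_mono) auto
      ultimately show ?thesis
        using True \<rho> by (simp add: log_drift_def algebra_simps)
    qed
  qed
qed

section \<open>Discrete self-decomposability\<close>

theorem proposition4p2:
  fixes \<alpha> \<gamma> \<delta> :: real
  assumes "\<alpha> \<in> {0<..2}"
    and "ds_admissible \<alpha> \<gamma> \<delta>"
  shows "discretely_self_decomposable (discrete_stable \<alpha> \<gamma> \<delta>) \<longleftrightarrow>
    \<delta> \<ge> (if \<alpha> \<noteq> 1 then \<alpha>^2 * \<gamma> else 2 * \<gamma>)"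
proof -
  have \<delta>: "\<alpha> * \<gamma> \<le> \<delta>" and sign: "ds_sign \<alpha> \<gamma>"
    using assms by (cases \<alpha> "1::real" rule: linorder_cases;
      auto simp: ds_admissible_def ds_sign_def zero_le_mult_iff)+
  note pgf = pgf_discrete_stable[OF assms(1) sign \<delta>]
  have *: "(\<exists>q. \<forall>z\<in>{-1..1}. pgf (discrete_stable \<alpha> \<gamma> \<delta>) z =
        pgf (discrete_stable \<alpha> \<gamma> \<delta>) (1 + \<rho> * (z - 1)) * pgf q z) \<longleftrightarrow>
      \<alpha> * (\<gamma> * (1 - \<rho> powr \<alpha>)) \<le> \<delta> * (1 - \<rho>) + \<gamma> * log_drift \<alpha> \<rho>"
    if \<rho>: "\<rho> \<in> {0..1}" for \<rho>
  proof -
    have "0 \<le> 1 - \<rho> powr \<alpha>" using \<rho> assms(1) by (simp add: powr_le1)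
    then have sign': "ds_sign \<alpha> (\<gamma> * (1 - \<rho> powr \<alpha>))"
      using sign mult_nonneg_nonneg[of "\<gamma> * (\<alpha> - 1)" "1 - \<rho> powr \<alpha>"]
      by (auto simp: ds_sign_def mult_ac)
    have "pgf (discrete_stable \<alpha> \<gamma> \<delta>) z =
          pgf (discrete_stable \<alpha> \<gamma> \<delta>) (1 + \<rho> * (z - 1)) * pgf q z \<longleftrightarrow>
        pgf q z =
          ds_pgf \<alpha> (\<gamma> * (1 - \<rho> powr \<alpha>)) (\<delta> * (1 - \<rho>) + \<gamma> * log_drift \<alpha> \<rho>) z"
      if z: "z \<in> {-1..1}" for q z
    proof -
      have "\<rho> * (1 - z) \<le> 1 * (1 - z)"
        using \<rho> z by (intro mult_right_mono) auto
      moreover have "0 \<le> \<rho> * (1 - z)"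
        using \<rho> z by (intro mult_nonneg_nonneg) auto
      ultimately have "1 + \<rho> * (z - 1) \<in> {-1..1}" using z by (auto simp: algebra_simps)
      moreover have "ds_pgf \<alpha> \<gamma> \<delta> (1 + \<rho> * (z - 1)) \<noteq> 0" by (simp add: ds_pgf_eq)
      ultimately show ?thesis
        using ds_pgf_quotient[of \<rho> z \<alpha> \<gamma> \<delta>] \<rho> z by (auto simp: pgf field_simps)
    qed
    then show ?thesis
      using ds_pgf_is_pgf_iff[OF assms(1) sign'] by simp
  qed
  show ?thesis
    unfolding discretely_self_decomposable_def
    using thinned_parameters_admissible_iff[OF _ sign] assms(1) by (simp add: *)
qed

end
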